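(* For all integers $k,\ell,m \geq 1$, the following identity of formal power series in $t$ with coefficients in $\mathbb{Z}[x]$ holds: $$\begin{aligned} Q_{132}^{(0,k,\ell,m)}(t,x) ={}& \sum_{p=0}^{k+m-2} C_p t^p + \frac{C_{k+m-1}t^{k+m-1}}{1-t} \\ &+ \frac{t}{1-t}\sum_{i=0}^{k-2} C_i t^i \left( Q_{132}^{(0,k-1-i,\ell,m)}(t,x) -\sum_{r=0}^{k-i+m-2} C_rt^r\right) \\ &+ \frac{t}{1-t} \left( Q_{132}^{(0,k,\ell,0)}(t,x) - \sum_{a=0}^{k-2} C_a t^a \right) \left( Q_{132}^{(0,0,\ell,m)}(t,x) - \sum_{b=0}^{m-1} C_b t^b \right) \\ &+ \frac{t}{1-t}\sum_{j=1}^{m-1} C_j t^j \left( Q_{132}^{(0,k,\ell,m-j)}(t,x) - \sum_{s=0}^{k+m-j-2} C_st^s\right). \end{aligned}$$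
   Context: Let $\mathbb{N}=\{0,1,2,\ldots\}$. $S_n$ is the set of permutations $\sigma=\sigma_1\ldots\sigma_n$ of $\{1,\ldots,n\}$ in one-line notation, and $S_n(132)$ is the set of $\sigma\in S_n$ that avoid the pattern $132$, i.e. for which there are no indices $i<j<k$ with $\sigma_i<\sigma_k<\sigma_j$. For $a,b,c,d\in\mathbb{N}$, $\sigma_i$ matches the quadrant marked mesh pattern $\mathrm{MMP}(a,b,c,d)$ in $\sigma$ if all of the following hold: there are at least $a$ indices $j>i$ with $\sigma_j>\sigma_i$; at least $b$ indices $j<i$ with $\sigma_j>\sigma_i$; at least $c$ indices $j<i$ with $\sigma_j<\sigma_i$; and at least $d$ indices $j>i$ with $\sigma_j<\sigma_i$. Let $\mathrm{mmp}^{(a,b,c,d)}(\sigma)$ be the number of $i$ such that $\sigma_i$ matches $\mathrm{MMP}(a,b,c,d)$ in $\sigma$. For $n\ge 1$ put $Q_{n,132}^{(a,b,c,d)}(x)=\sum_{\sigma\in S_n(132)}x^{\mathrm{mmp}^{(a,b,c,d)}(\sigma)}$, and $Q_{132}^{(a,b,c,d)}(t,x)=1+\sum_{n\ge1}t^nQ_{n,132}^{(a,b,c,d)}(x)$. $C_n=\frac{1}{n+1}\binom{2n}{n}$ is the $n$-th Catalan number. Empty sums are $0$, and $\frac{1}{1-t}=\sum_{n\ge0}t^n$. *)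

theory Defs
  imports
    "HOL-Combinatorics.Combinatorics"
    "HOL-Computational_Algebra.Computational_Algebra"
begin

text \<open>
  Permutations are in one-line notation: lists enumerating \<open>{1..n}\<close> without repetition.
  List positions are counted from 0, so \<open>\<sigma> ! i\<close> is the entry usually
  written with index \<open>i + 1\<close>; only the relative order of positions matters below.
\<close>

definition avoids_132 :: "nat list \<Rightarrow> bool" where
  "avoids_132 \<sigma> \<longleftrightarrow>
     \<not> (\<exists>i j k. i < j \<and> j < k \<and> k < length \<sigma> \<and> \<sigma> ! i < \<sigma> ! k \<and> \<sigma> ! k < \<sigma> ! j)"

definition S132 :: "nat \<Rightarrow> nat list set" where
  "S132 n = {\<sigma> \<in> permutations_of_set {1..n}. avoids_132 \<sigma>}"

definition matches_MMP :: "nat \<Rightarrow> nat \<Rightarrow> nat \<Rightarrow> nat \<Rightarrow> nat list \<Rightarrow> nat \<Rightarrow> bool" where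
  "matches_MMP a b c d \<sigma> i \<longleftrightarrow>
     a \<le> card {j. i < j \<and> j < length \<sigma> \<and> \<sigma> ! i < \<sigma> ! j} \<and>
     b \<le> card {j. j < i \<and> \<sigma> ! i < \<sigma> ! j} \<and>
     c \<le> card {j. j < i \<and> \<sigma> ! j < \<sigma> ! i} \<and>
     d \<le> card {j. i < j \<and> j < length \<sigma> \<and> \<sigma> ! j < \<sigma> ! i}"

definition mmp :: "nat \<Rightarrow> nat \<Rightarrow> nat \<Rightarrow> nat \<Rightarrow> nat list \<Rightarrow> nat" where
  "mmp a b c d \<sigma> = card {i. i < length \<sigma> \<and> matches_MMP a b c d \<sigma> i}"

definition Q132_poly :: "nat \<Rightarrow> nat \<Rightarrow> nat \<Rightarrow> nat \<Rightarrow> nat \<Rightarrow> int poly" where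
  "Q132_poly a b c d n = (\<Sum>\<sigma>\<in>S132 n. monom 1 (mmp a b c d \<sigma>))"

text \<open>The variable \<open>t\<close> is \<^const>\<open>fps_X\<close>; the variable \<open>x\<close> is the polynomial variable.\<close>

definition Q132 :: "nat \<Rightarrow> nat \<Rightarrow> nat \<Rightarrow> nat \<Rightarrow> int poly fps" where
  "Q132 a b c d = Abs_fps (\<lambda>n. if n = 0 then 1 else Q132_poly a b c d n)"

text \<open>The division is exact.\<close>

definition catalan :: "nat \<Rightarrow> nat" where
  "catalan n = ((2 * n) choose n) div (n + 1)"

definition catalan_term :: "nat \<Rightarrow> int poly fps" where
  "catalan_term n = of_nat (catalan n) * fps_X ^ n"

text \<open>
  The series \<open>1 / (1 - t)\<close>, given by its coefficients because division of formal power
  series is only available over fields.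
\<close>

definition geometric_fps :: "int poly fps" where
  "geometric_fps = Abs_fps (\<lambda>n. 1)"

end

theory Submission
  imports Defs
begin

text \<open>
  In a 132-avoiding permutation every entry left of the maximum exceeds every entry right of it:
  otherwise the two entries together with the maximum would form the pattern. Hence a nonempty
  132-avoider is an upper block \<open>A\<close>, then the maximum, then a lower block \<open>B\<close>, with
  \<open>A\<close> and \<open>B\<close> arbitrary 132-avoiders (up to a shift of values). Let \<open>p\<close>
  and \<open>q\<close> be their lengths.

  The quadrant counts behave well under this decomposition. An entry of \<open>A\<close> sees all of
  \<open>B\<close> to its lower right, so its demand \<open>m\<close> drops to \<open>m - q\<close>; an entry of
  \<open>B\<close> sees all of \<open>A\<close> and the maximum to its upper left, so its demand
  \<open>k\<close> drops to \<open>k - 1 - p\<close>; nothing else changes, except that the maximum itself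
  has nothing above it and fails to match because \<open>k \<ge> 1\<close>. With truncated subtraction this
  gives (\<open>Q132_poly_Suc\<close>), writing \<open>Q n (k, m)\<close> for the coefficient of
  \<open>t\<close> to the power \<open>n\<close> in \<open>Q132 0 k l m\<close>,
  \<open>Q (n + 1) (k, m) = (\<Sum>p + q = n. Q p (k, m - q) * Q q (k - 1 - p, m))\<close>.

  An entry with \<open>b\<close> larger entries before it and \<open>d\<close> smaller ones after it needs a
  permutation of length greater than \<open>b + d\<close>. So for \<open>n \<le> b + d\<close> nothing matches and
  the coefficient is the number of 132-avoiders, which is the Catalan number
  (\<open>Q132_poly_eq_catalan\<close>). This accounts for the subtracted partial sums, which remove exactly
  such low coefficients. For \<open>n + 1 \<ge> k + m\<close> it also simplifies each product of the
  recurrence: if \<open>p \<le> k - 2\<close> the first factor is a Catalan number, if \<open>q \<le> m - 1\<close>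
  the second one is, and otherwise both demands reduced by the decomposition are \<open>0\<close>. These three
  ranges are disjoint and produce the three sums of the theorem. The summand with \<open>q = 0\<close> is
  \<open>Q n (k, m)\<close> itself; moving it to the left side (\<open>Q132_poly_diff\<close>) yields the
  coefficients of \<open>(1 - t) * Q132 0 k l m\<close>, and hence the factor \<open>1 / (1 - t)\<close>.
\<close>

section \<open>Catalan numbers\<close>

lemma catalan_mult: "(n + 1) * catalan n = (2 * n) choose n"
proof -
  have "(n + 1) * ((2 * n) choose (n + 1)) = n * ((2 * n) choose n)"
    using binomial_absorb_comp[of "2 * n" n] binomial_absorption[of n "2 * n"]
    by (simp only: Suc_eq_plus1 mult_2 diff_add_inverse2)
  hence "(n + 1) * (((2 * n) choose n) - ((2 * n) choose (n + 1))) = (2 * n) choose n"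
    by (simp only: diff_mult_distrib2) simp
  hence "(n + 1) dvd ((2 * n) choose n)"
    by (metis dvd_triv_left)
  thus ?thesis
    unfolding catalan_def by (rule dvd_mult_div_cancel)
qed

lemma catalan_0: "catalan 0 = 1"
  by (simp add: catalan_def)

lemma catalan_Suc: "(n + 2) * catalan (Suc n) = (4 * n + 2) * catalan n"
proof -
  let ?B = "(2 * n) choose n" and ?B' = "(2 * Suc n) choose (Suc n)"
  have 1: "Suc n * ?B' = Suc (2 * n + 1) * (Suc (2 * n) choose n)"
    using Suc_times_binomial_eq[of "Suc (2 * n)" n] by simp
  have 2: "(Suc (2 * n) - n) * (Suc (2 * n) choose n) = Suc (2 * n) * ?B"
    using binomial_absorb_comp[of "Suc (2 * n)" n] by simp
  have "Suc n * (Suc n * ?B') = 2 * Suc n * (Suc n * (Suc (2 * n) choose n))"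
    unfolding 1 by (simp add: algebra_simps)
  also have "\<dots> = Suc n * ((4 * n + 2) * ?B)"
    using 2 by (simp add: algebra_simps)
  finally have "Suc n * ?B' = (4 * n + 2) * ?B"
    by (simp only: Suc_mult_cancel1)
  moreover have "?B' = (n + 2) * catalan (Suc n)"
    using catalan_mult[of "Suc n"] by simp
  moreover have "?B = Suc n * catalan n"
    using catalan_mult[of n] by simp
  ultimately have "Suc n * ((n + 2) * catalan (Suc n)) = Suc n * ((4 * n + 2) * catalan n)"
    by (simp only: mult.left_commute)
  thus ?thesis
    by (simp only: mult_cancel1) simp
qed

text \<open>
  The weights \<open>i\<close> and \<open>n - i\<close> give the same sum by symmetry, and they add up to
  \<open>n\<close>.
\<close>

lemma catalan_convolution_weighted:
  "2 * (\<Sum>i\<le>n. i * (catalan i * catalan (n - i))) = n * (\<Sum>i\<le>n. catalan i * catalan (n - i))"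
proof -
  have "(\<Sum>i\<le>n. i * (catalan i * catalan (n - i))) = (\<Sum>i\<le>n. (n - i) * (catalan i * catalan (n - i)))"
    by (rule sum.reindex_bij_witness[of _ "\<lambda>i. n - i" "\<lambda>i. n - i"]) auto
  hence "2 * (\<Sum>i\<le>n. i * (catalan i * catalan (n - i))) =
      (\<Sum>i\<le>n. i * (catalan i * catalan (n - i)) + (n - i) * (catalan i * catalan (n - i)))"
    by (simp add: sum.distrib)
  also have "\<dots> = (\<Sum>i\<le>n. n * (catalan i * catalan (n - i)))"
    by (intro sum.cong) (auto simp flip: add_mult_distrib)
  finally show ?thesis
    by (simp add: sum_distrib_left)
qed

text \<open>
  The recurrence follows from the closed form by induction. Shifting the index in the sum weighted by
  \<open>i + 1\<close> and replacing \<open>(i + 2) * catalan (i + 1)\<close> by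
  \<open>(4 * i + 2) * catalan i\<close> expresses the convolution at \<open>n + 1\<close>, weighted and
  unweighted, by those at \<open>n\<close>; the weighted sums are then eliminated by the symmetry above.
\<close>

lemma catalan_convolution: "(\<Sum>i\<le>n. catalan i * catalan (n - i)) = catalan (Suc n)"
proof (induction n)
  case 0
  then show ?case using catalan_Suc[of 0] by (simp add: catalan_0)
next
  case (Suc n)
  let ?S = "\<lambda>n. \<Sum>i\<le>n. catalan i * catalan (n - i)"
  let ?T = "\<lambda>n. \<Sum>i\<le>n. i * (catalan i * catalan (n - i))"
  have "?T (Suc n) + ?S (Suc n) = (\<Sum>i\<le>Suc n. (i + 1) * (catalan i * catalan (Suc n - i)))"
    by (simp only: add_mult_distrib sum.distrib mult_1)
  also have "\<dots> = catalan (Suc n) + (\<Sum>i\<le>n. ((i + 2) * catalan (Suc i)) * catalan (n - i))"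
    by (simp only: sum.atMost_Suc_shift) (simp add: catalan_0 algebra_simps)
  also have "(\<Sum>i\<le>n. ((i + 2) * catalan (Suc i)) * catalan (n - i)) = 4 * ?T n + 2 * ?S n"
    by (simp only: catalan_Suc)
      (simp add: sum_distrib_left sum.distrib algebra_simps)
  finally have "2 * ?T (Suc n) + 2 * ?S (Suc n) = 2 * catalan (Suc n) + 4 * (2 * ?T n) + 4 * ?S n"
    by linarith
  hence "(n + 3) * ?S (Suc n) = 2 * catalan (Suc n) + 4 * (n * ?S n) + 4 * ?S n"
    unfolding catalan_convolution_weighted by (simp add: add_mult_distrib del: sum.atMost_Suc)
  also have "\<dots> = (4 * Suc n + 2) * catalan (Suc n)"
    unfolding Suc.IH by (simp add: algebra_simps)
  also have "\<dots> = (n + 3) * catalan (Suc (Suc n))"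
    using catalan_Suc[of "Suc n"] by (simp add: algebra_simps)
  finally show ?case
    by (simp only: mult_cancel1) simp
qed

section \<open>The decomposition at the maximum\<close>

definition join :: "nat list \<Rightarrow> nat list \<Rightarrow> nat list" where
  "join A B = map (\<lambda>x. x + length B) A @ Suc (length A + length B) # B"

lemma length_join: "length (join A B) = Suc (length A + length B)"
  by (simp add: join_def)

lemma nth_join_left: "i < length A \<Longrightarrow> join A B ! i = A ! i + length B"
  by (simp add: join_def nth_append)

lemma nth_join_max: "join A B ! length A = Suc (length A + length B)"
  by (simp add: join_def nth_append)

lemma nth_join_right: "join A B ! (Suc (length A) + i) = B ! i"
  by (simp add: join_def nth_append)

text \<open>
  Positions in a joined list belong to the left block, the maximum or the right block; most proofs
  below are by this case distinction.
\<close>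

lemma less_join_cases:
  assumes "i < length (join A B)"
  obtains (left) "i < length A" | (max) "i = length A"
    | (right) i' where "i = Suc (length A) + i'" "i' < length B"
proof (cases i "length A" rule: linorder_cases)
  case greater
  then obtain i' where "i = Suc (length A) + i'"
    using less_iff_Suc_add by auto
  with assms show ?thesis
    using right by (simp add: length_join)
qed (use left max in blast)+

lemma S132_iff:
  "\<sigma> \<in> S132 n \<longleftrightarrow> set \<sigma> = {1..n} \<and> distinct \<sigma> \<and> avoids_132 \<sigma>"
  by (auto simp: S132_def permutations_of_set_def)

lemma finite_S132: "finite (S132 n)"
  by (auto simp: S132_def)

lemma length_S132: "\<sigma> \<in> S132 n \<Longrightarrow> length \<sigma> = n"
  by (auto simp: S132_def dest: length_finite_permutations_of_set)

lemma nth_S132: "\<sigma> \<in> S132 n \<Longrightarrow> i < n \<Longrightarrow> 1 \<le> \<sigma> ! i \<and> \<sigma> ! i \<le> n"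
  using length_S132[of \<sigma> n] nth_mem[of i \<sigma>] by (auto simp: S132_iff)

lemma S132_0: "S132 0 = {[]}"
  by (auto simp: S132_iff avoids_132_def)

text \<open>
  A forbidden triple would end in some position \<open>k\<close>. If \<open>k\<close> is in the left block,
  the triple lies in \<open>A\<close>; the maximum cannot be the middle value of the triple; if \<open>k\<close>
  is in the right block, the smallest value cannot come from the larger entries to the left, so that
  the triple lies in \<open>B\<close>.
\<close>

lemma avoids_132_join:
  assumes "A \<in> S132 p" "B \<in> S132 q"
  shows "avoids_132 (join A B)"
  unfolding avoids_132_def
proof safe
  fix i j k
  assume ijk: "i < j" "j < k" and k: "k < length (join A B)"
    and less: "join A B ! i < join A B ! k" "join A B ! k < join A B ! j"
  have len: "length A = p" "length B = q"
    using assms by (auto simp: length_S132)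
  have i: "i < length (join A B)" and j: "j < length (join A B)"
    using ijk k by auto
  show False
    using k
  proof (cases rule: less_join_cases)
    case left
    with ijk less have "A ! i < A ! k \<and> A ! k < A ! j"
      by (simp add: nth_join_left)
    with ijk left assms(1) show False
      by (auto simp: S132_iff avoids_132_def)
  next
    case max
    with ijk less nth_S132[OF assms(1), of j] nth_join_max[of A B] len show False
      by (simp add: nth_join_left)
  next
    case (right k')
    have Bk: "join A B ! k \<le> q"
      using nth_S132[OF assms(2), of k'] right len nth_join_right[of A B k'] by auto
    show False
      using i
    proof (cases rule: less_join_cases)
      case left
      with less Bk len show False
        by (simp add: nth_join_left)
    next
      case max
      with less Bk nth_join_max[of A B] len show False
        by simp
    next
      case i': (right i')
      have "j > length A"
        using i' ijk by simp
      with j obtain j' where j': "j = Suc (length A) + j'"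
        by (cases rule: less_join_cases) auto
      show False
        using less ijk right i' j' assms(2)
        by (auto simp: nth_join_right S132_iff avoids_132_def simp del: add_Suc)
    qed
  qed
qed

lemma join_in_S132:
  assumes "A \<in> S132 p" "B \<in> S132 q"
  shows "join A B \<in> S132 (Suc (p + q))"
proof -
  have len: "length A = p" "length B = q"
    using assms by (auto simp: length_S132)
  have sets: "set A = {1..p}" "set B = {1..q}" "distinct A" "distinct B"
    using assms by (auto simp: S132_iff)
  have "(\<lambda>x. x + q) ` {1..p} = {Suc q..p + q}"
    by (simp add: image_add_atLeastAtMost')
  hence "set (join A B) = {1..Suc (p + q)}" "distinct (join A B)"
    using sets by (auto simp: join_def len distinct_map)
  thus ?thesis
    using avoids_132_join[OF assms] by (simp add: S132_iff)
qed

lemma initial_segment_if_below: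
  fixes X Y :: "nat set"
  assumes un: "X \<union> Y = {1..n}" and below: "\<And>x y. x \<in> X \<Longrightarrow> y \<in> Y \<Longrightarrow> y < x"
  shows "Y = {1..card Y}"
proof (cases "Y = {}")
  case False
  have fin: "finite Y"
    using un by (metis finite_Un finite_atLeastAtMost)
  have "Y = {1..Max Y}"
  proof
    show "Y \<subseteq> {1..Max Y}"
      using un fin by auto
    show "{1..Max Y} \<subseteq> Y"
    proof
      fix y assume y: "y \<in> {1..Max Y}"
      have Max: "Max Y \<in> Y"
        using fin False by simp
      have "y \<notin> X"
        using below[OF _ Max, of y] y by auto
      moreover have "y \<in> {1..n}"
        using un Max y by (metis UnI2 atLeastAtMost_iff le_trans)
      ultimately show "y \<in> Y"
        using un by auto
    qed
  qed
  moreover from this have "card Y = Max Y"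
    by (metis card_atLeastAtMost diff_Suc_1)
  ultimately show ?thesis
    by simp
qed auto

lemma avoids_132_appendD:
  assumes "avoids_132 (xs @ ys)"
  shows "avoids_132 xs" "avoids_132 ys"
proof -
  show "avoids_132 xs"
    unfolding avoids_132_def
  proof safe
    fix i j k assume h: "i < j" "j < k" "k < length xs" "xs ! i < xs ! k" "xs ! k < xs ! j"
    hence "k < length (xs @ ys) \<and> (xs @ ys) ! i < (xs @ ys) ! k \<and> (xs @ ys) ! k < (xs @ ys) ! j"
      by (simp add: nth_append)
    with h(1,2) assms show False
      unfolding avoids_132_def by blast
  qed
  show "avoids_132 ys"
    unfolding avoids_132_def
  proof safe
    fix i j k assume h: "i < j" "j < k" "k < length ys" "ys ! i < ys ! k" "ys ! k < ys ! j"
    let ?s = "\<lambda>i. length xs + i"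
    have "?s i < ?s j \<and> ?s j < ?s k \<and> ?s k < length (xs @ ys) \<and>
        (xs @ ys) ! ?s i < (xs @ ys) ! ?s k \<and> (xs @ ys) ! ?s k < (xs @ ys) ! ?s j"
      using h by simp
    with assms show False
      unfolding avoids_132_def by blast
  qed
qed

lemma avoids_132_map_diff:
  assumes "avoids_132 xs"
  shows "avoids_132 (map (\<lambda>x. x - q) xs)"
  unfolding avoids_132_def
proof safe
  fix i j k
  assume h: "i < j" "j < k" "k < length (map (\<lambda>x. x - q) xs)"
    "map (\<lambda>x. x - q) xs ! i < map (\<lambda>x. x - q) xs ! k"
    "map (\<lambda>x. x - q) xs ! k < map (\<lambda>x. x - q) xs ! j"
  hence "xs ! i < xs ! k" "xs ! k < xs ! j"
    by auto
  with h assms show False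
    unfolding avoids_132_def by auto
qed

text \<open>
  Every nonempty 132-avoider is a join: split it at its maximum. Avoidance puts the values on the
  right of the maximum below those on its left, so they form an initial segment of the values, and
  subtracting its length from the left part normalizes that part.
\<close>

lemma S132_Suc_obtain_join:
  assumes "\<sigma> \<in> S132 (Suc n)"
  obtains A B where "A \<in> S132 (length A)" "B \<in> S132 (length B)"
    "length A + length B = n" "\<sigma> = join A B"
proof -
  have \<sigma>: "set \<sigma> = {1..Suc n}" "distinct \<sigma>" "avoids_132 \<sigma>"
    using assms by (auto simp: S132_iff)
  hence "Suc n \<in> set \<sigma>"
    by simp
  then obtain xs ys where split: "\<sigma> = xs @ Suc n # ys"
    by (meson split_list)
  have sets: "set xs \<union> set ys = {1..n}"
  proof -
    have "set xs \<union> set ys = {1..Suc n} - {Suc n}"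
      using \<sigma> unfolding split by auto
    also have "\<dots> = {1..n}"
      by (simp add: atLeastAtMostSuc_conv)
    finally show ?thesis .
  qed
  have below: "y < x" if x: "x \<in> set xs" and y: "y \<in> set ys" for x y
  proof (rule ccontr)
    assume "\<not> y < x"
    moreover have "x \<noteq> y"
      using x y \<sigma>(2) unfolding split by auto
    ultimately have "x < y"
      by simp
    have "y \<in> {1..n}"
      using y sets by blast
    hence "y < Suc n"
      by simp
    obtain i k where i: "i < length xs" "xs ! i = x" and k: "k < length ys" "ys ! k = y"
      using x y by (metis in_set_conv_nth)
    \<comment> \<open>The smaller entry on the left, the maximum and the larger entry on the right form a 132.\<close>
    have "i < length xs \<and> length xs < Suc (length xs + k) \<and> Suc (length xs + k) < length \<sigma>
        \<and> \<sigma> ! i < \<sigma> ! Suc (length xs + k) \<and> \<sigma> ! Suc (length xs + k) < \<sigma> ! length xs"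
      using i k \<open>x < y\<close> \<open>y < Suc n\<close> unfolding split by (simp add: nth_append)
    with \<sigma>(3) show False
      unfolding avoids_132_def by blast
  qed
  have dist: "distinct xs" "distinct ys"
    using \<sigma>(2) unfolding split by auto
  have len: "length xs + length ys = n"
    using length_S132[OF assms] unfolding split by simp
  have ys: "set ys = {1..length ys}"
    using initial_segment_if_below[OF sets below] dist by (simp add: distinct_card)
  have xs: "set xs = {Suc (length ys)..length xs + length ys}"
  proof -
    have "set xs \<inter> set ys = {}"
      using below less_irrefl by blast
    hence "set xs = {1..n} - set ys"
      using sets by blast
    also have "\<dots> = {Suc (length ys)..length xs + length ys}"
      unfolding ys using len by auto
    finally show ?thesis .
  qed
  define A where "A = map (\<lambda>x. x - length ys) xs"
  have "map (\<lambda>x. x + length ys) A = map (\<lambda>x. x) xs"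
    unfolding A_def map_map o_def using xs by (intro map_cong) auto
  hence join: "\<sigma> = join A ys"
    using len unfolding split join_def by (simp add: A_def)
  have "ys \<in> S132 (length ys)"
    using ys dist avoids_132_appendD(2)[of "xs @ [Suc n]" ys] \<sigma>(3) unfolding split
    by (simp add: S132_iff)
  moreover have "A \<in> S132 (length A)"
  proof -
    have "set A = {1..length A}"
    proof (intro equalityI subsetI)
      fix y assume "y \<in> {1..length A}"
      hence "y = (y + length ys) - length ys" "y + length ys \<in> set xs"
        unfolding xs by (auto simp: A_def)
      thus "y \<in> set A"
        unfolding A_def set_map by (rule image_eqI)
    qed (auto simp: A_def xs)
    moreover have "distinct A"
      unfolding A_def distinct_map using dist xs by (auto intro!: inj_onI)
    moreover have "avoids_132 A"
      using \<sigma>(3) unfolding A_def split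
      by (rule avoids_132_map_diff[OF avoids_132_appendD(1)])
    ultimately show ?thesis
      by (simp add: S132_iff)
  qed
  moreover have "length A + length ys = n"
    using len by (simp add: A_def)
  ultimately show thesis
    using join by (intro that)
qed

lemma join_inject:
  assumes "length A = length A'" "length B = length B'"
  shows "join A B = join A' B' \<longleftrightarrow> A = A' \<and> B = B'"
  using assms by (auto simp: join_def inj_map_eq_map inj_def)

text \<open>
  Injectivity holds because the position of the maximum determines \<open>p\<close>, and then the two
  blocks are determined.
\<close>

lemma bij_betw_join:
  "bij_betw (\<lambda>(p, A, B). join A B) (SIGMA p:{..n}. S132 p \<times> S132 (n - p)) (S132 (Suc n))"
  unfolding bij_betw_def
proof
  show "inj_on (\<lambda>(p, A, B). join A B) (SIGMA p:{..n}. S132 p \<times> S132 (n - p))"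
  proof (rule inj_onI)
    fix x y
    assume x: "x \<in> (SIGMA p:{..n}. S132 p \<times> S132 (n - p))"
      and y: "y \<in> (SIGMA p:{..n}. S132 p \<times> S132 (n - p))"
      and xy: "(case x of (p, A, B) \<Rightarrow> join A B) = (case y of (p, A, B) \<Rightarrow> join A B)"
    from x obtain p A B where [simp]: "x = (p, A, B)"
      and h: "p \<le> n" "A \<in> S132 p" "B \<in> S132 (n - p)"
      by auto
    from y obtain p' A' B' where [simp]: "y = (p', A', B')"
      and h': "p' \<le> n" "A' \<in> S132 p'" "B' \<in> S132 (n - p')"
      by auto
    from xy have eq: "join A B = join A' B'"
      by simp
    have len: "length A = p" "length B = n - p" "length A' = p'" "length B' = n - p'"
      using h h' by (auto dest: length_S132)
    have "p = p'"
    proof (rule ccontr)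
      assume "p \<noteq> p'"
      have "distinct (join A B)"
        using join_in_S132[OF h(2,3)] by (simp add: S132_iff)
      moreover have "join A B ! p = Suc n" "join A B ! p' = Suc n"
        using nth_join_max[of A B] nth_join_max[of A' B'] eq len h h' by auto
      moreover have "p < length (join A B)" "p' < length (join A B)"
        using eq len h h' length_join[of A B] by auto
      ultimately show False
        using \<open>p \<noteq> p'\<close> by (metis nth_eq_iff_index_eq)
    qed
    with eq show "x = y"
      using join_inject[of A A' B B'] len by simp
  qed
  show "(\<lambda>(p, A, B). join A B) ` (SIGMA p:{..n}. S132 p \<times> S132 (n - p)) = S132 (Suc n)" (is "?L = _")
  proof (intro equalityI subsetI)
    fix \<sigma> assume "\<sigma> \<in> ?L"
    then obtain p A B where "p \<le> n" "A \<in> S132 p" "B \<in> S132 (n - p)" "\<sigma> = join A B"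
      by auto
    thus "\<sigma> \<in> S132 (Suc n)"
      using join_in_S132[of A p B "n - p"] by simp
  next
    fix \<sigma> assume "\<sigma> \<in> S132 (Suc n)"
    then obtain A B where AB: "A \<in> S132 (length A)" "B \<in> S132 (length B)"
      "length A + length B = n" "\<sigma> = join A B"
      by (rule S132_Suc_obtain_join)
    hence "(length A, A, B) \<in> (SIGMA p:{..n}. S132 p \<times> S132 (n - p))"
      by auto
    thus "\<sigma> \<in> ?L"
      using AB(4) by force
  qed
qed

lemma card_S132: "card (S132 n) = catalan n"
proof (induction n rule: less_induct)
  case (less n)
  show ?case
  proof (cases n)
    case (Suc n')
    have "card (S132 n) = card (SIGMA p:{..n'}. S132 p \<times> S132 (n' - p))"
      unfolding Suc using bij_betw_same_card[OF bij_betw_join[of n']] by simp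
    also have "\<dots> = (\<Sum>p\<le>n'. card (S132 p) * card (S132 (n' - p)))"
      by (subst card_SigmaI) (auto simp: finite_S132 card_cartesian_product)
    also have "\<dots> = (\<Sum>p\<le>n'. catalan p * catalan (n' - p))"
      using less.IH Suc by (intro sum.cong) auto
    finally show ?thesis
      by (simp add: catalan_convolution Suc)
  qed (simp add: S132_0 catalan_0)
qed

section \<open>Matches in a joined permutation\<close>

text \<open>
  Only the lower right quadrant of an entry in the left block grows: it gains the whole right block.
\<close>

lemma matches_join_left:
  assumes A: "A \<in> S132 p" and B: "B \<in> S132 q" and i: "i < p"
  shows "matches_MMP 0 k l m (join A B) i \<longleftrightarrow> matches_MMP 0 k l (m - q) A i"
proof -
  have len: "length A = p" "length B = q"
    using A B by (auto simp: length_S132)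
  have II: "{j. j < i \<and> join A B ! i < join A B ! j} = {j. j < i \<and> A ! i < A ! j}"
    and III: "{j. j < i \<and> join A B ! j < join A B ! i} = {j. j < i \<and> A ! j < A ! i}"
    using i len by (auto simp: nth_join_left)
  let ?IV = "{j. i < j \<and> j < length A \<and> A ! j < A ! i}"
  have "{j. i < j \<and> j < length (join A B) \<and> join A B ! j < join A B ! i} =
      ?IV \<union> {Suc p..<Suc p + q}" (is "?L = ?R")
  proof (intro set_eqI iffI)
    fix j assume j: "j \<in> ?L"
    hence "j < length (join A B)"
      by simp
    thus "j \<in> ?R"
      using j i nth_S132[OF A i] nth_join_max[of A B] by (cases rule: less_join_cases)
        (auto simp: nth_join_left len)
  next
    fix j assume j: "j \<in> ?R"
    show "j \<in> ?L"
    proof (cases "j < p")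
      case True
      with j i len show ?thesis
        by (auto simp: nth_join_left length_join)
    next
      case False
      with j len have "j \<in> {Suc p..<Suc p + q}"
        by auto
      then obtain j' where j': "j = Suc p + j'" "j' < q"
        by (auto simp: le_iff_add)
      have "B ! j' \<le> q" "1 \<le> A ! i"
        using nth_S132[OF B j'(2)] nth_S132[OF A i] by auto
      hence "join A B ! (Suc (length A) + j') < join A B ! i"
        using i len nth_join_left[of i A B] nth_join_right[of A B j'] by linarith
      thus ?thesis
        using j' i len by (auto simp: length_join)
    qed
  qed
  also have "card \<dots> = card ?IV + q"
    using len by (subst card_Un_disjoint) auto
  finally show ?thesis
    unfolding matches_MMP_def II III by auto
qed

text \<open>
  Only the upper left quadrant of an entry in the right block grows: it gains the left block and the
  maximum, which is \<open>Suc p\<close> entries.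
\<close>

lemma matches_join_right:
  assumes A: "A \<in> S132 p" and B: "B \<in> S132 q" and i: "i < q"
  shows "matches_MMP 0 k l m (join A B) (Suc p + i) \<longleftrightarrow> matches_MMP 0 (k - Suc p) l m B i"
proof -
  have len: "length A = p" "length B = q"
    using A B by (auto simp: length_S132)
  note [simp del] = add_Suc
  have at_right: "join A B ! (Suc p + j) = B ! j" for j
    using nth_join_right[of A B j] len by simp
  have at_left: "B ! i < join A B ! j" if "j < Suc p" for j
    using that nth_S132[OF B i] nth_S132[OF A, of j] len nth_join_max[of A B]
    by (cases "j = p") (auto simp: nth_join_left)
  have split: "{j. j < Suc p + i \<and> P j} = {j. j < Suc p \<and> P j} \<union> (+) (Suc p) ` {j. j < i \<and> P (Suc p + j)}"
    for P
  proof (intro set_eqI iffI)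
    fix j assume j: "j \<in> {j. j < Suc p + i \<and> P j}"
    show "j \<in> {j. j < Suc p \<and> P j} \<union> (+) (Suc p) ` {j. j < i \<and> P (Suc p + j)}"
    proof (cases "j < Suc p")
      case False
      then obtain j' where "j = Suc p + j'"
        using le_Suc_ex not_less by blast
      with j show ?thesis
        by auto
    qed (use j in auto)
  qed auto
  have II: "card {j. j < Suc p + i \<and> join A B ! (Suc p + i) < join A B ! j} =
      Suc p + card {j. j < i \<and> B ! i < B ! j}"
  proof -
    have "{j. j < Suc p \<and> B ! i < join A B ! j} = {..<Suc p}"
      using at_left by auto
    thus ?thesis
      unfolding at_right split by (subst card_Un_disjoint) (auto simp: at_right card_image)
  qed
  have III: "card {j. j < Suc p + i \<and> join A B ! j < join A B ! (Suc p + i)} =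
      card {j. j < i \<and> B ! j < B ! i}"
  proof -
    have "{j. j < Suc p \<and> join A B ! j < B ! i} = {}"
      using at_left by (auto dest: less_asym)
    thus ?thesis
      unfolding at_right split by (simp only: Un_empty_left at_right) (simp add: card_image)
  qed
  have "{j. Suc p + i < j \<and> j < length (join A B) \<and> join A B ! j < join A B ! (Suc p + i)} =
      (+) (Suc p) ` {j. i < j \<and> j < length B \<and> B ! j < B ! i}" (is "?L = ?R")
  proof (intro set_eqI iffI)
    fix j assume j: "j \<in> ?L"
    then obtain j' where "j = Suc p + j'"
      using le_Suc_ex[of "Suc p" j] by auto
    moreover from this j have "i < j'" "j' < length B" "B ! j' < B ! i"
      by (auto simp: at_right length_join len)
    ultimately show "j \<in> ?R"
      by blast
  next
    fix j assume "j \<in> ?R"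
    then obtain j' where "j = Suc p + j'" "i < j'" "j' < length B" "B ! j' < B ! i"
      by auto
    thus "j \<in> ?L"
      by (simp add: at_right length_join len)
  qed
  hence IV: "card {j. Suc p + i < j \<and> j < length (join A B) \<and> join A B ! j < join A B ! (Suc p + i)} =
      card {j. i < j \<and> j < length B \<and> B ! j < B ! i}"
    by (simp add: card_image)
  show ?thesis
    unfolding matches_MMP_def II III IV by auto
qed

lemma no_match_join_max:
  assumes A: "A \<in> S132 p" and B: "B \<in> S132 q" and k: "k \<ge> 1"
  shows "\<not> matches_MMP 0 k l m (join A B) p"
proof -
  have len: "length A = p" "length B = q"
    using A B by (auto simp: length_S132)
  have "join A B ! j < join A B ! p" if "j < p" for j
    using that nth_S132[OF A that] len nth_join_max[of A B] by (simp add: nth_join_left)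
  hence "{j. j < p \<and> join A B ! p < join A B ! j} = {}"
    by (auto dest: less_asym)
  thus ?thesis
    unfolding matches_MMP_def using k by (simp only: card.empty) simp
qed

lemma mmp_join:
  assumes A: "A \<in> S132 p" and B: "B \<in> S132 q" and k: "k \<ge> 1"
  shows "mmp 0 k l m (join A B) = mmp 0 k l (m - q) A + mmp 0 (k - Suc p) l m B"
proof -
  have len: "length A = p" "length B = q"
    using A B by (auto simp: length_S132)
  let ?M = "matches_MMP 0 k l m (join A B)"
  let ?MA = "{i. i < p \<and> matches_MMP 0 k l (m - q) A i}"
  let ?MB = "{i. i < q \<and> matches_MMP 0 (k - Suc p) l m B i}"
  have "{i. i < length (join A B) \<and> ?M i} = ?MA \<union> (+) (Suc p) ` ?MB" (is "?L = ?R")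
  proof (intro set_eqI iffI)
    fix i assume i: "i \<in> ?L"
    hence "i < length (join A B)"
      by simp
    thus "i \<in> ?R"
    proof (cases rule: less_join_cases)
      case left
      with i show ?thesis
        using matches_join_left[OF A B, of i] len by auto
    next
      case max
      with i show ?thesis
        using no_match_join_max[OF A B k] len by auto
    next
      case (right i')
      with i have "i' \<in> ?MB"
        using matches_join_right[OF A B, of i'] len by (simp del: add_Suc)
      with right(1) len show ?thesis
        by blast
    qed
  next
    fix i assume "i \<in> ?R"
    thus "i \<in> ?L"
      using matches_join_left[OF A B] matches_join_right[OF A B]
      by (auto simp: length_join len)
  qed
  moreover have "?MA \<inter> (+) (Suc p) ` ?MB = {}"
    by auto
  ultimately show ?thesis
    unfolding mmp_def len by (simp add: card_Un_disjoint card_image del: add_Suc)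
qed

text \<open>
  The upper left and the lower right quadrant of an entry are disjoint and do not contain the entry,
  so a match needs more than \<open>b + d\<close> positions.
\<close>

lemma mmp_eq_0:
  assumes "length \<sigma> \<le> b + d"
  shows "mmp a b c d \<sigma> = 0"
proof -
  have "\<not> matches_MMP a b c d \<sigma> i" if i: "i < length \<sigma>" for i
  proof
    assume "matches_MMP a b c d \<sigma> i"
    hence "b + d \<le> card {j. j < i \<and> \<sigma> ! i < \<sigma> ! j} + card {j. i < j \<and> j < length \<sigma> \<and> \<sigma> ! j < \<sigma> ! i}"
      unfolding matches_MMP_def by simp
    also have "\<dots> \<le> card {..<i} + card {i<..<length \<sigma>}"
      by (intro add_mono card_mono) auto
    also have "\<dots> < length \<sigma>"
      using i by simp
    finally show False
      using assms by simp
  qed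
  thus ?thesis
    unfolding mmp_def by (simp add: card_eq_0_iff)
qed

section \<open>Recurrence for the coefficients\<close>

lemma Q132_poly_eq_catalan:
  assumes "n \<le> b + d"
  shows "Q132_poly a b c d n = of_nat (catalan n)"
proof -
  have "Q132_poly a b c d n = (\<Sum>\<sigma>\<in>S132 n. 1)"
    unfolding Q132_poly_def using assms by (intro sum.cong) (simp_all add: length_S132 mmp_eq_0)
  thus ?thesis
    by (simp add: card_S132)
qed

lemma Q132_poly_Suc:
  assumes "k \<ge> 1"
  shows "Q132_poly 0 k l m (Suc n) =
    (\<Sum>p\<le>n. Q132_poly 0 k l (m - (n - p)) p * Q132_poly 0 (k - Suc p) l m (n - p))"
proof -
  let ?f = "\<lambda>\<sigma>. monom 1 (mmp 0 k l m \<sigma>) :: int poly"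
  have "Q132_poly 0 k l m (Suc n) =
      (\<Sum>(p, A, B)\<in>(SIGMA p:{..n}. S132 p \<times> S132 (n - p)). ?f (join A B))"
    unfolding Q132_poly_def
    using sum.reindex_bij_betw[OF bij_betw_join[of n], of ?f] by (simp add: case_prod_unfold)
  also have "\<dots> = (\<Sum>p\<le>n. \<Sum>(A, B)\<in>S132 p \<times> S132 (n - p). ?f (join A B))"
    by (subst sum.Sigma) (auto simp: finite_S132)
  also have "\<dots> = (\<Sum>p\<le>n. \<Sum>(A, B)\<in>S132 p \<times> S132 (n - p).
      monom 1 (mmp 0 k l (m - (n - p)) A) * monom 1 (mmp 0 (k - Suc p) l m B))"
    using mmp_join[OF _ _ assms] by (intro sum.cong) (auto simp: mult_monom)
  also have "\<dots> = (\<Sum>p\<le>n. Q132_poly 0 k l (m - (n - p)) p * Q132_poly 0 (k - Suc p) l m (n - p))"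
    unfolding Q132_poly_def by (simp add: sum_product sum.cartesian_product)
  finally show ?thesis .
qed

text \<open>
  The recurrence with its summands grouped by whether \<open>p < k - 1\<close>, whether the right block
  has length \<open>n - p < m\<close>, or neither. The bound on \<open>n\<close> makes the first two
  conditions exclusive.
\<close>

lemma Q132_poly_diff:
  assumes "k \<ge> 1" "m \<ge> 1" "k + m \<le> Suc n"
  shows "Q132_poly 0 k l m (Suc n) - Q132_poly 0 k l m n =
      (\<Sum>i<k - 1. of_nat (catalan i) * Q132_poly 0 (k - 1 - i) l m (n - i))
    + (\<Sum>p=k - 1..n - m. Q132_poly 0 k l 0 p * Q132_poly 0 0 l m (n - p))
    + (\<Sum>j=1..m - 1. of_nat (catalan j) * Q132_poly 0 k l (m - j) (n - j))"
proof -
  let ?g = "\<lambda>p. Q132_poly 0 k l (m - (n - p)) p * Q132_poly 0 (k - Suc p) l m (n - p)"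
  let ?U = "{..<k - 1}" and ?V = "{k - 1..n - m}" and ?W = "{Suc (n - m)..n}"
  have "Q132_poly 0 k l m (Suc n) = sum ?g {..n}"
    by (rule Q132_poly_Suc[OF assms(1)])
  also have "{..n} = ?U \<union> (?V \<union> ?W)"
    using assms by auto
  also have "sum ?g (?U \<union> (?V \<union> ?W)) = sum ?g ?U + sum ?g (?V \<union> ?W)"
    using assms by (intro sum.union_disjoint) auto
  also have "sum ?g (?V \<union> ?W) = sum ?g ?V + sum ?g ?W"
    by (intro sum.union_disjoint) auto
  also have "sum ?g {..<k - 1} = (\<Sum>i<k - 1. of_nat (catalan i) * Q132_poly 0 (k - 1 - i) l m (n - i))"
    by (intro sum.cong) (auto simp: Q132_poly_eq_catalan)
  also have "sum ?g {k - 1..n - m} = (\<Sum>p=k - 1..n - m. Q132_poly 0 k l 0 p * Q132_poly 0 0 l m (n - p))"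
    using assms by (intro sum.cong) (auto simp: Suc_le_eq)
  also have "sum ?g {Suc (n - m)..n} = (\<Sum>j<m. of_nat (catalan j) * Q132_poly 0 k l (m - j) (n - j))"
    using assms
    by (intro sum.reindex_bij_witness[of _ "\<lambda>j. n - j" "\<lambda>p. n - p"]) (auto simp: Q132_poly_eq_catalan)
  \<comment> \<open>The summand for \<open>j = 0\<close> is the term subtracted on the left side of the claim.\<close>
  also have "{..<m} = insert 0 {1..m - 1}"
    using assms by auto
  finally show ?thesis
    by (simp add: catalan_0 algebra_simps)
qed

section \<open>Power series\<close>

lemma fps_nth_Q132: "fps_nth (Q132 a b c d) n = Q132_poly a b c d n"
  by (simp add: Q132_def Q132_poly_eq_catalan catalan_0)

lemma fps_nth_catalan_term: "fps_nth (catalan_term p) n = (if n = p then of_nat (catalan p) else 0)"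
  by (simp add: catalan_term_def fps_of_nat [symmetric])

lemma fps_nth_catalan_term_mult:
  "fps_nth (catalan_term p * F) n = (if n < p then 0 else of_nat (catalan p) * fps_nth F (n - p))"
  by (simp add: catalan_term_def mult.assoc fps_X_power_mult_nth fps_of_nat [symmetric])

lemma fps_nth_sum_catalan_term:
  "fps_nth (\<Sum>p<N. catalan_term p) n = (if n < N then of_nat (catalan n) else 0)"
  by (simp add: fps_sum_nth fps_nth_catalan_term)

text \<open>
  As long as \<open>N\<close> does not exceed \<open>b + d + 1\<close>, the subtracted Catalan terms cancel the
  first \<open>N\<close> coefficients exactly.
\<close>

lemma fps_nth_Q132_tail:
  assumes "N \<le> Suc (b + d)"
  shows "fps_nth (Q132 a b c d - (\<Sum>r<N. catalan_term r)) n = (if n < N then 0 else Q132_poly a b c d n)"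
  using assms by (simp add: fps_nth_Q132 fps_nth_sum_catalan_term Q132_poly_eq_catalan)

lemma fps_nth_mult_tails:
  fixes F G :: "'a::comm_ring_1 fps"
  assumes "\<And>i. i < M \<Longrightarrow> fps_nth F i = 0" "\<And>i. i < N \<Longrightarrow> fps_nth G i = 0"
  shows "fps_nth (F * G) n = (if n < M + N then 0 else \<Sum>i=M..n - N. fps_nth F i * fps_nth G (n - i))"
proof -
  have "fps_nth (F * G) n = (\<Sum>i=0..n. fps_nth F i * fps_nth G (n - i))"
    by (simp add: fps_mult_nth)
  also have "\<dots> = (\<Sum>i\<in>{i. M \<le> i \<and> i + N \<le> n}. fps_nth F i * fps_nth G (n - i))"
  proof (intro sum.mono_neutral_right ballI)
    fix i assume "i \<in> {0..n} - {i. M \<le> i \<and> i + N \<le> n}"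
    hence "i < M \<or> n - i < N"
      by auto
    with assms show "fps_nth F i * fps_nth G (n - i) = 0"
      by auto
  qed auto
  also have "{i. M \<le> i \<and> i + N \<le> n} = (if n < M + N then {} else {M..n - N})"
    by auto
  finally show ?thesis
    by (auto split: if_splits)
qed

lemma geometric_fps_inverse: "(1 - fps_X) * geometric_fps = 1"
  by (rule fps_ext) (auto simp: geometric_fps_def algebra_simps)

theorem theorem10:
  fixes k l m :: nat
  assumes "k \<ge> 1" and "l \<ge> 1" and "m \<ge> 1"
  shows "Q132 0 k l m =
      (\<Sum>p<k + m - 1. catalan_term p) + catalan_term (k + m - 1) * geometric_fps
    + fps_X * geometric_fps *
        (\<Sum>i<k - 1. catalan_term i *
           (Q132 0 (k - 1 - i) l m - (\<Sum>r<k - i + m - 1. catalan_term r)))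
    + fps_X * geometric_fps *
        (Q132 0 k l 0 - (\<Sum>a<k - 1. catalan_term a)) *
        (Q132 0 0 l m - (\<Sum>b<m. catalan_term b))
    + fps_X * geometric_fps *
        (\<Sum>j = 1..m - 1. catalan_term j *
           (Q132 0 k l (m - j) - (\<Sum>s<k + m - j - 1. catalan_term s)))"
proof -
  let ?N = "k + m - 1"
  define S where "S = (\<Sum>p<?N. catalan_term p)"
  define T1 where "T1 = (\<Sum>i<k - 1. catalan_term i *
           (Q132 0 (k - 1 - i) l m - (\<Sum>r<k - i + m - 1. catalan_term r)))"
  define T2 where "T2 = (Q132 0 k l 0 - (\<Sum>a<k - 1. catalan_term a)) *
        (Q132 0 0 l m - (\<Sum>b<m. catalan_term b))"
  define T3 where "T3 = (\<Sum>j = 1..m - 1. catalan_term j *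
           (Q132 0 k l (m - j) - (\<Sum>s<k + m - j - 1. catalan_term s)))"
  \<comment> \<open>Each of the three products of series starts at the same exponent \<open>k + m - 1\<close>.\<close>
  have T1: "fps_nth T1 n = (if n < ?N then 0 else
      \<Sum>i<k - 1. of_nat (catalan i) * Q132_poly 0 (k - 1 - i) l m (n - i))" for n
  proof -
    have "fps_nth T1 n = (\<Sum>i<k - 1. if n < ?N then 0 else
        of_nat (catalan i) * Q132_poly 0 (k - 1 - i) l m (n - i))"
      unfolding T1_def fps_sum_nth
    proof (intro sum.cong refl)
      fix i assume "i \<in> {..<k - 1}"
      hence i: "i < k - 1"
        by simp
      have "fps_nth (Q132 0 (k - 1 - i) l m - (\<Sum>r<k - i + m - 1. catalan_term r)) (n - i) =
          (if n - i < k - i + m - 1 then 0 else Q132_poly 0 (k - 1 - i) l m (n - i))"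
        using i by (intro fps_nth_Q132_tail) auto
      moreover have "n - i < k - i + m - 1 \<longleftrightarrow> n < ?N" "n < i \<Longrightarrow> n < ?N"
        using i assms by auto
      ultimately show "fps_nth (catalan_term i *
            (Q132 0 (k - 1 - i) l m - (\<Sum>r<k - i + m - 1. catalan_term r))) n =
          (if n < ?N then 0 else of_nat (catalan i) * Q132_poly 0 (k - 1 - i) l m (n - i))"
        unfolding fps_nth_catalan_term_mult by simp
    qed
    thus ?thesis
      by simp
  qed
  have T2: "fps_nth T2 n = (if n < ?N then 0 else
      \<Sum>p=k - 1..n - m. Q132_poly 0 k l 0 p * Q132_poly 0 0 l m (n - p))" for n
  proof -
    have "fps_nth T2 n = (if n < k - 1 + m then 0 else
        \<Sum>p=k - 1..n - m. fps_nth (Q132 0 k l 0 - (\<Sum>a<k - 1. catalan_term a)) p *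
          fps_nth (Q132 0 0 l m - (\<Sum>b<m. catalan_term b)) (n - p))"
      unfolding T2_def by (intro fps_nth_mult_tails; subst fps_nth_Q132_tail) auto
    also have "\<dots> = (if n < ?N then 0 else
        \<Sum>p=k - 1..n - m. Q132_poly 0 k l 0 p * Q132_poly 0 0 l m (n - p))"
      using assms by (auto intro!: sum.cong simp: fps_nth_Q132_tail simp del: fps_sub_nth)
    finally show ?thesis .
  qed
  have T3: "fps_nth T3 n = (if n < ?N then 0 else
      \<Sum>j=1..m - 1. of_nat (catalan j) * Q132_poly 0 k l (m - j) (n - j))" for n
  proof -
    have "fps_nth T3 n = (\<Sum>j=1..m - 1. if n < ?N then 0 else
        of_nat (catalan j) * Q132_poly 0 k l (m - j) (n - j))"
      unfolding T3_def fps_sum_nth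
    proof (intro sum.cong refl)
      fix j assume "j \<in> {1..m - 1}"
      hence j: "1 \<le> j" "j < m"
        by auto
      have "fps_nth (Q132 0 k l (m - j) - (\<Sum>s<k + m - j - 1. catalan_term s)) (n - j) =
          (if n - j < k + m - j - 1 then 0 else Q132_poly 0 k l (m - j) (n - j))"
        using j by (intro fps_nth_Q132_tail) auto
      moreover have "n - j < k + m - j - 1 \<longleftrightarrow> n < ?N" "n < j \<Longrightarrow> n < ?N"
        using j assms by auto
      ultimately show "fps_nth (catalan_term j *
            (Q132 0 k l (m - j) - (\<Sum>s<k + m - j - 1. catalan_term s))) n =
          (if n < ?N then 0 else of_nat (catalan j) * Q132_poly 0 k l (m - j) (n - j))"
        unfolding fps_nth_catalan_term_mult by simp
    qed
    thus ?thesis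
      by simp
  qed
  have main: "(1 - fps_X) * Q132 0 k l m = (1 - fps_X) * S + catalan_term ?N + fps_X * (T1 + T2 + T3)"
  proof (rule fps_ext)
    fix n
    show "fps_nth ((1 - fps_X) * Q132 0 k l m) n =
      fps_nth ((1 - fps_X) * S + catalan_term ?N + fps_X * (T1 + T2 + T3)) n"
    proof (cases n)
      case 0
      with assms show ?thesis
        by (simp add: S_def fps_nth_sum_catalan_term fps_nth_Q132 Q132_poly_eq_catalan
            fps_nth_catalan_term del: fps_sum_nth)
    next
      case (Suc n')
      have lhs: "fps_nth ((1 - fps_X) * Q132 0 k l m) n = Q132_poly 0 k l m (Suc n') - Q132_poly 0 k l m n'"
        by (simp add: Suc left_diff_distrib fps_nth_Q132)
      have rhs: "fps_nth ((1 - fps_X) * S + catalan_term ?N + fps_X * (T1 + T2 + T3)) n =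
          fps_nth S (Suc n') - fps_nth S n' + fps_nth (catalan_term ?N) (Suc n')
          + (fps_nth T1 n' + fps_nth T2 n' + fps_nth T3 n')"
        by (simp add: Suc left_diff_distrib)
      show ?thesis
        \<comment> \<open>Below the threshold all coefficients are Catalan numbers; from there on the recurrence applies.\<close>
      proof (cases "n' < ?N")
        case True
        hence "fps_nth S (Suc n') - fps_nth S n' + fps_nth (catalan_term ?N) (Suc n') =
            of_nat (catalan (Suc n')) - of_nat (catalan n')"
          by (auto simp: S_def fps_nth_sum_catalan_term fps_nth_catalan_term)
        with True show ?thesis
          unfolding lhs rhs T1 T2 T3 by (simp add: Q132_poly_eq_catalan)
      next
        case False
        hence "fps_nth S (Suc n') - fps_nth S n' + fps_nth (catalan_term ?N) (Suc n') = 0"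
          by (auto simp: S_def fps_nth_sum_catalan_term fps_nth_catalan_term)
        moreover have "k + m \<le> Suc n'"
          using False by simp
        ultimately show ?thesis
          unfolding lhs rhs T1 T2 T3 using False Q132_poly_diff[OF assms(1,3)] by simp
      qed
    qed
  qed
  have "Q132 0 k l m = ((1 - fps_X) * geometric_fps) * Q132 0 k l m"
    by (simp add: geometric_fps_inverse)
  also have "\<dots> = geometric_fps * ((1 - fps_X) * Q132 0 k l m)"
    by (simp only: ac_simps)
  also have "\<dots> = ((1 - fps_X) * geometric_fps) * S + catalan_term ?N * geometric_fps
      + fps_X * geometric_fps * T1 + fps_X * geometric_fps * T2 + fps_X * geometric_fps * T3"
    unfolding main by (simp only: distrib_left ac_simps)
  finally show ?thesis
    unfolding geometric_fps_inverse S_def T1_def T2_def T3_def by (simp only: mult_1 mult.assoc)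
qed

end
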